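(* Let $q$ be a prime power, let $N,D$ be integers with $D\ge3$, $N\ge2D$, set $\tau=-q^{(-N-1)/2}$, and let $\ell^\pm_i\in\mathbb C[\zeta,\zeta^{-1}]$ ($-1\le i\le D$) be the non-symmetric dual $q$-Hahn polynomials ($0\le i\le D-1$) together with the boundary Laurent polynomials $\ell^\pm_{-1},\ell^\pm_D$. Then the following identities hold in $\mathbb C[\zeta,\zeta^{-1}]$ for $0\le i\le D-1$: (i) $$\zeta\ell^-_i=\tau(q^i-q^D)(q^{N-D+1}-q^{i+1}+1)\,\ell^+_{i-1}+\tau q^i(q^{N-D+1}-q^{i+1}+1)\,\ell^-_i+\tau(1-q^{i+1})(q^D-q^{i+1}+1)\,\ell^+_i+\tau(q^{i+1}-1)^2\,\ell^-_{i+1},$$ $$\zeta^{-1}\ell^-_i=\tau(1-q^{i-D})(q^{N+1}-q^{D+i})\,\ell^-_{i-1}+\tau(q^D-q^i)(q^{N-D+1}-q^i+1)\,\ell^+_{i-1}+\tau q^{i+1}(q^D-q^i+1)\,\ell^-_i+\tau(q^{i+1}-1)(q^D-q^i+1)\,\ell^+_i.$$ (ii) $$\zeta\ell^+_i=\tau q^{N+1}(q^{i-D}-1)(q^{D-N+i}-1)\,\ell^+_{i-1}+\tau q^{N-D+1+i}(q^{D-N+i}-1)\,\ell^-_i+\tau q^{i+1}(q^D-q^{i+1}+1)\,\ell^+_i+\tau q^{i+1}(1-q^{i+1})\,\ell^-_{i+1},$$ $$\zeta^{-1}\ell^+_i=\tau q^{N-D+2+i}(1-q^{D-N+i})\,\ell^-_i+\tau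 q^{i+1}(q^{N-D+1}-q^{i+1}+1)\,\ell^+_i+\tau q^{i+2}(q^{i+1}-1)\,\ell^-_{i+1}+\tau(q^{i+1}-1)(q^{i+2}-1)\,\ell^+_{i+1}.$$
   Context: Notation: $(\alpha;q)_n=\prod_{j=0}^{n-1}(1-\alpha q^j)$ and ${}_3\phi_2\!\left(\begin{smallmatrix}\alpha_1,\alpha_2,\alpha_3\\ \beta_1,\beta_2\end{smallmatrix}\middle|q;z\right)=\sum_{n\ge0}\frac{(\alpha_1;q)_n(\alpha_2;q)_n(\alpha_3;q)_n}{(\beta_1;q)_n(\beta_2;q)_n}\frac{z^n}{(q;q)_n}$ (below the sums terminate at $n=i$ because of the factor $(q^{-i};q)_n$). Define $$h_i(\zeta)=\frac{(q^{D-N};q)_i(q^{-D};q)_i}{\tau^i}\,{}_3\phi_2\!\left(\begin{matrix}q^{-i},\tau\zeta^{-1},\tau\zeta\\ q^{D-N},q^{-D}\end{matrix}\middle|q;q\right)\quad(0\le i\le D),$$ $$h^\perp_i(\zeta)=\frac{(q^{D-N+1};q)_i(q^{2-D};q)_i}{(\tau q)^i}\,{}_3\phi_2\!\left(\begin{matrix}q^{-i},\tau q\zeta^{-1},\tau q\zeta\\ q^{D-N+1},q^{2-D}\end{matrix}\middle|q;q\right)\quad(0\le i\le D-2),$$ $$h^\perp_{D-1}(\zeta)=\prod_{j=1}^{D-1}(\zeta+\zeta^{-1}-\tau q^j-\tau^{-1}q^{-j}),\qquad p^\perp(\zeta)=\zeta^{-1}(\zeta-\tau)(\zeta-\tau^{-1}q^{-D}).$$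 For $0\le i\le D-1$, $$\ell^-_i=\frac{q^D-q^i}{\tau^i(q^D-1)(q;q)_i^2}\Big(h_i-\frac{1-q^i}{q^D-q^i}p^\perp h^\perp_{i-1}\Big),\qquad \ell^+_i=\frac{q^{i+1}-1}{\tau^{i+1}(q^D-1)(q;q)_{i+1}^2}\big(h_{i+1}-p^\perp h^\perp_i\big),$$ where for $i=0$ the term containing $h^\perp_{-1}$ is $0$. The boundary polynomials are $\ell^\pm_{-1}=0$ and $$\ell^-_D=\frac{1}{\tau^D(q;q)_D^2}\,p^\perp h^\perp_{D-1},\qquad \ell^+_D=\frac{\tau q^{D+1}-\zeta^{-1}}{\tau^{D+1}(q;q)_D(q;q)_{D+1}}\,p^\perp h^\perp_{D-1}.$$ *)

theory Defs
  imports
    Complex_Main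
    "HOL-Library.Poly_Mapping"
    "HOL-Number_Theory.Prime_Powers"
begin

text \<open>
  The ring of Laurent polynomials in one variable zeta over the complex numbers is the group
  algebra of the additive group of integers: finitely supported functions from exponents to
  coefficients, with convolution as multiplication.
\<close>

type_synonym laurent_poly = "int \<Rightarrow>\<^sub>0 complex"

definition Const :: "complex \<Rightarrow> laurent_poly" where
  "Const c = Poly_Mapping.single 0 c"

definition zeta :: laurent_poly where
  "zeta = Poly_Mapping.single 1 1"

definition zeta_inv :: laurent_poly where
  "zeta_inv = Poly_Mapping.single (- 1) 1"

lemma zeta_mult_zeta_inv: "zeta * zeta_inv = 1"
  by (simp add: zeta_def zeta_inv_def mult_single)

lemma Const_0 [simp]: "Const 0 = 0"
  by (simp add: Const_def)

lemma Const_1 [simp]: "Const 1 = 1"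
  by (simp add: Const_def)

lemma Const_add: "Const (a + b) = Const a + Const b"
  by (simp add: Const_def single_add)

lemma Const_mult: "Const (a * b) = Const a * Const b"
  by (simp add: Const_def mult_single)

definition qpoch :: "'a::comm_ring_1 \<Rightarrow> 'a \<Rightarrow> nat \<Rightarrow> 'a" where
  "qpoch a q n = (\<Prod>j<n. 1 - a * q ^ j)"

text \<open>
  The basic hypergeometric series with scalar parameters \<open>a1\<close>, \<open>b1\<close>, \<open>b2\<close>, \<open>q\<close>, \<open>z\<close> and Laurent
  polynomial parameters \<open>A2\<close>, \<open>A3\<close>.  \<open>Sum_any\<close> is the sum over all \<open>n\<close> of a family with only
  finitely many nonzero members; this is the case for \<open>a1 = q\<^sup>-\<^sup>i\<close>, see the lemma below.  (If
  \<open>(b1;q)\<^sub>n\<close> or \<open>(b2;q)\<^sub>n\<close> vanishes for some \<open>n > i\<close>, then the numerator vanishes as well and the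
  term is \<open>0\<close>.)
\<close>

definition phi32 ::
  "complex \<Rightarrow> laurent_poly \<Rightarrow> laurent_poly \<Rightarrow> complex \<Rightarrow> complex \<Rightarrow> complex \<Rightarrow> complex \<Rightarrow> laurent_poly" where
  "phi32 a1 A2 A3 b1 b2 q z =
     Sum_any (\<lambda>n. Const (qpoch a1 q n / (qpoch b1 q n * qpoch b2 q n) * (z ^ n / qpoch q q n))
                    * qpoch A2 (Const q) n * qpoch A3 (Const q) n)"

lemma qpoch_neg_power_eq_0:
  fixes q :: complex
  assumes "q \<noteq> 0" and "i < n"
  shows "qpoch (q powi (- int i)) q n = 0"
proof -
  have "1 - q powi (- int i) * q ^ i = 0"
    using assms(1) by (simp add: power_int_minus)
  then show ?thesis
    using assms(2) unfolding qpoch_def by (intro prod_zero) auto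
qed

lemma phi32_terminates:
  assumes "q \<noteq> 0"
  shows "phi32 (q powi (- int i)) A2 A3 b1 b2 q z =
    (\<Sum>n\<le>i. Const (qpoch (q powi (- int i)) q n / (qpoch b1 q n * qpoch b2 q n) * (z ^ n / qpoch q q n))
               * qpoch A2 (Const q) n * qpoch A3 (Const q) n)"
  unfolding phi32_def
proof (rule Sum_any.expand_superset)
  show "finite {..i}" by simp
next
  have zero: "qpoch (q powi (- int i)) q n = 0" if "\<not> n \<le> i" for n
    using that qpoch_neg_power_eq_0[OF assms] by simp
  have "Const (qpoch (q powi (- int i)) q n / (qpoch b1 q n * qpoch b2 q n) * (z ^ n / qpoch q q n))
               * qpoch A2 (Const q) n * qpoch A3 (Const q) n = 0" if "\<not> n \<le> i" for n
    by (simp only: zero[OF that] div_0 mult_zero_left Const_0)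
  then show "{n. Const (qpoch (q powi (- int i)) q n / (qpoch b1 q n * qpoch b2 q n) * (z ^ n / qpoch q q n))
               * qpoch A2 (Const q) n * qpoch A3 (Const q) n \<noteq> 0} \<subseteq> {..i}"
    by blast
qed

definition h :: "complex \<Rightarrow> complex \<Rightarrow> int \<Rightarrow> int \<Rightarrow> int \<Rightarrow> laurent_poly" where
  "h q \<tau> N D i =
     Const (qpoch (q powi (D - N)) q (nat i) * qpoch (q powi (- D)) q (nat i) / \<tau> powi i)
     * phi32 (q powi (- i)) (Const \<tau> * zeta_inv) (Const \<tau> * zeta)
             (q powi (D - N)) (q powi (- D)) q q"

text \<open>
  \<open>hperp q \<tau> N D i\<close> is meant for \<open>0 \<le> i \<le> D - 1\<close>.  The value \<open>0\<close> at \<open>i = -1\<close> reflects the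
  convention that the term with index \<open>-1\<close> in \<open>ell_minus\<close> is \<open>0\<close>.
\<close>

definition hperp :: "complex \<Rightarrow> complex \<Rightarrow> int \<Rightarrow> int \<Rightarrow> int \<Rightarrow> laurent_poly" where
  "hperp q \<tau> N D i =
     (if 0 \<le> i \<and> i \<le> D - 2 then
        Const (qpoch (q powi (D - N + 1)) q (nat i) * qpoch (q powi (2 - D)) q (nat i) / (\<tau> * q) powi i)
        * phi32 (q powi (- i)) (Const (\<tau> * q) * zeta_inv) (Const (\<tau> * q) * zeta)
                (q powi (D - N + 1)) (q powi (2 - D)) q q
      else if i = D - 1 then
        (\<Prod>j\<in>{1..D - 1}. zeta + zeta_inv - Const (\<tau> * q powi j) - Const (inverse \<tau> * q powi (- j)))
      else 0)"

definition pperp :: "complex \<Rightarrow> complex \<Rightarrow> int \<Rightarrow> laurent_poly" where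
  "pperp q \<tau> D = zeta_inv * (zeta - Const \<tau>) * (zeta - Const (inverse \<tau> * q powi (- D)))"

text \<open>
  Both families are indexed by \<open>-1 \<le> i \<le> D\<close>; the final \<open>else\<close> branch covers \<open>i = -1\<close> (and the
  irrelevant indices outside this range).
\<close>

definition ell_minus :: "complex \<Rightarrow> complex \<Rightarrow> int \<Rightarrow> int \<Rightarrow> int \<Rightarrow> laurent_poly" where
  "ell_minus q \<tau> N D i =
     (if 0 \<le> i \<and> i \<le> D - 1 then
        Const ((q powi D - q powi i) / (\<tau> powi i * (q powi D - 1) * (qpoch q q (nat i))\<^sup>2))
        * (h q \<tau> N D i
           - Const ((1 - q powi i) / (q powi D - q powi i)) * pperp q \<tau> D * hperp q \<tau> N D (i - 1))
      else if i = D then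
        Const (1 / (\<tau> powi D * (qpoch q q (nat D))\<^sup>2)) * pperp q \<tau> D * hperp q \<tau> N D (D - 1)
      else 0)"

definition ell_plus :: "complex \<Rightarrow> complex \<Rightarrow> int \<Rightarrow> int \<Rightarrow> int \<Rightarrow> laurent_poly" where
  "ell_plus q \<tau> N D i =
     (if 0 \<le> i \<and> i \<le> D - 1 then
        Const ((q powi (i + 1) - 1) / (\<tau> powi (i + 1) * (q powi D - 1) * (qpoch q q (nat (i + 1)))\<^sup>2))
        * (h q \<tau> N D (i + 1) - pperp q \<tau> D * hperp q \<tau> N D i)
      else if i = D then
        Const (1 / (\<tau> powi (D + 1) * qpoch q q (nat D) * qpoch q q (nat (D + 1))))
        * (Const (\<tau> * q powi (D + 1)) - zeta_inv) * pperp q \<tau> D * hperp q \<tau> N D (D - 1)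
      else 0)"

end

theory Submission
  imports Defs
begin

text \<open>
  With \<open>E = q\<^sup>D\<close>, \<open>B = q E \<tau>\<close> and \<open>C = 1 / (E \<tau>)\<close>, the polynomials \<open>h\<^sub>i\<close> are the monic continuous
  dual q-Hahn polynomials in \<open>X = \<zeta> + \<zeta>\<inverse>\<close> with parameters \<open>\<tau>, B, C\<close>, and \<open>h\<^sup>\<bottom>\<^sub>i\<close> those with parameters
  \<open>q\<tau>, B, qC\<close>.  Their three-term recurrence is symmetric in the parameters, so the contiguous
  relations for \<open>\<tau> \<mapsto> q\<tau>\<close> also give those for \<open>C \<mapsto> qC\<close>.  Since
  \<open>p\<^sup>\<bottom> = (1 - \<tau>\<zeta>\<inverse>)(\<zeta> - C) = (1 - \<tau>C)\<zeta> + \<tau>C X - (\<tau> + C)\<close>, multiplication by \<open>\<zeta>\<close> amounts to multiplication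
  by \<open>X\<close> and by \<open>p\<^sup>\<bottom>\<close>; the former is the recurrence, and the latter is given by the expansion of \<open>h\<^sub>i\<close>
  in the \<open>h\<^sup>\<bottom>\<^sub>j\<close> and that of \<open>p\<^sup>\<bottom>(\<zeta>) p\<^sup>\<bottom>(\<zeta>\<inverse>) h\<^sup>\<bottom>\<^sub>i\<close> in the \<open>h\<^sub>j\<close>.  The claimed identities are then
  comparisons of coefficients of \<open>h\<^sub>j\<close> and \<open>p\<^sup>\<bottom>h\<^sup>\<bottom>\<^sub>j\<close>.
\<close>

section \<open>Continuous dual q-Hahn polynomials: recurrence and contiguous relations\<close>

text \<open>
  Normalised as \<open>p\<^sub>n = (tB;q)\<^sub>n (tC;q)\<^sub>n t\<^sup>-\<^sup>n \<^sub>3\<phi>\<^sub>2\<close>, which is monic in \<open>X\<close> and symmetric in \<open>t, B, C\<close>.  The coefficient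
  \<open>q\<^sup>n\<^sup>-\<^sup>1(1 - q\<^sup>n)\<close> of the usual recurrence vanishes at \<open>n = 0\<close>, so no inverse of \<open>q\<close> is needed.
\<close>

fun cdq_hahn :: "'a::idom \<Rightarrow> 'a \<Rightarrow> 'a \<Rightarrow> 'a \<Rightarrow> 'a \<Rightarrow> nat \<Rightarrow> 'a" where
  "cdq_hahn q X t B C 0 = 1"
| "cdq_hahn q X t B C (Suc 0) = X - (t + B + C - t * B * C)"
| "cdq_hahn q X t B C (Suc (Suc n)) =
     (X - ((t + B + C) * q ^ Suc n + t * B * C * (q ^ n * (1 - q ^ Suc n) - (q ^ Suc n)\<^sup>2)))
       * cdq_hahn q X t B C (Suc n)
     - (1 - q ^ Suc n) * (1 - B * C * q ^ n) * (1 - t * B * q ^ n) * (1 - t * C * q ^ n)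
       * cdq_hahn q X t B C n"

text \<open>Each coefficient of the recurrence is symmetric in \<open>t\<close>, \<open>B\<close>,
  \<open>C\<close>. Exchanging \<open>t\<close> and \<open>C\<close> is what later carries relations
  in \<open>t\<close> over to \<open>C\<close>.\<close>

lemma cdq_hahn_commute: "cdq_hahn q X t B C n = cdq_hahn q X C B t n"
  by (induction n rule: induct_nat_012) (simp_all only: cdq_hahn.simps, simp_all only: ac_simps)

text \<open>The two induction hypotheses and the recurrence of the shifted family reduce both sides
  to two consecutive shifted polynomials; a polynomial identity in \<open>q ^ n\<close>
  remains.\<close>

lemma cdq_hahn_shift:
  "cdq_hahn q X t B C (Suc n) =
     cdq_hahn q X (q * t) B C (Suc n)
     - t * (1 - q ^ Suc n) * (1 - B * C * q ^ n) * cdq_hahn q X (q * t) B C n"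
proof (induction n rule: induct_nat_012)
  case 0
  show ?case by (simp add: algebra_simps)
next
  case 1
  show ?case by (simp add: algebra_simps power2_eq_square)
next
  case (ge2 n)
  define a where "a = cdq_hahn q X (q * t) B C (Suc n)"
  define b where "b = cdq_hahn q X (q * t) B C n"
  define Q where "Q = q ^ n"
  show ?case
    unfolding cdq_hahn.simps(3)[of q X t B C "Suc n"] ge2
    unfolding cdq_hahn.simps(3) power_Suc
    unfolding a_def[symmetric] b_def[symmetric] Q_def[symmetric]
    by algebra
qed

text \<open>The way back from \<open>q * t\<close> to \<open>t\<close>; at X = \<zeta> + 1/\<zeta>
  the quadratic is (1 - t\<zeta>)(1 - t/\<zeta>). Once \<open>cdq_hahn_shift\<close> rewrites the
  right side in the shifted family, the claim follows from the recurrence of that family.\<close>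

lemma cdq_hahn_times_quadratic:
  "(1 + t\<^sup>2 - t * X) * cdq_hahn q X (q * t) B C n =
     (1 - t * B * q ^ n) * (1 - t * C * q ^ n) * cdq_hahn q X t B C n
     - t * cdq_hahn q X t B C (Suc n)"
proof (cases n)
  case 0
  then show ?thesis by (simp add: algebra_simps power2_eq_square)
next
  case (Suc m)
  define a where "a = cdq_hahn q X (q * t) B C (Suc m)"
  define b where "b = cdq_hahn q X (q * t) B C m"
  define Q where "Q = q ^ m"
  show ?thesis
    unfolding Suc cdq_hahn_shift[of q X t]
    unfolding cdq_hahn.simps(3) power_Suc
    unfolding a_def[symmetric] b_def[symmetric] Q_def[symmetric]
    by algebra
qed

section \<open>Series expansion in the Askey-Wilson basis\<close>

lemma qpoch_0 [simp]: "qpoch a q 0 = 1"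
  by (simp add: qpoch_def)

lemma qpoch_Suc: "qpoch a q (Suc n) = qpoch a q n * (1 - a * q ^ n)"
  by (simp add: qpoch_def)

lemma qpoch_add: "qpoch a q (m + n) = qpoch a q m * qpoch (a * q ^ m) q n"
  by (induction n) (simp_all add: qpoch_Suc power_add ac_simps)

lemma qpoch_Suc_left: "qpoch a q (Suc n) = (1 - a) * qpoch (q * a) q n"
  using qpoch_add[of a q 1 n] by (simp add: qpoch_Suc ac_simps)

lemma Const_diff: "Const (a - b) = Const a - Const b"
  by (simp add: Const_def single_diff)

lemma Const_uminus: "Const (- a) = - Const a"
  using Const_diff[of 0 a] by simp

lemma Const_eq_0_iff: "Const a = 0 \<longleftrightarrow> a = 0"
  by (metis Const_0 Const_def lookup_single_eq)

lemma Const_power: "Const (a ^ n) = Const a ^ n"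
  by (induction n) (simp_all add: Const_mult)

text \<open>For q nonzero and not a root of unity, this is (-1)^n q^(n(n+1)/2 - i n) times the
  Gaussian binomial coefficient of i over n.\<close>

definition qbinom_coeff :: "complex \<Rightarrow> nat \<Rightarrow> nat \<Rightarrow> complex" where
  "qbinom_coeff q i n = qpoch (q powi (- int i)) q n * q ^ n / qpoch q q n"

text \<open>
  This form of the q-Pascal rule is what makes the \<open>\<^sub>3\<phi>\<^sub>2\<close> series satisfy \<open>cdq_hahn_times_quadratic\<close>, a
  relation without shifts in the basis \<open>aw_basis\<close> that determines \<open>p\<^sub>n\<^sub>+\<^sub>1\<close> from \<open>p\<^sub>n\<close>.
\<close>

lemma qbinom_coeff_Suc:
  fixes q :: complex
  assumes "q \<noteq> 0" and "\<And>n. qpoch q q n \<noteq> 0"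
  shows "qbinom_coeff q (Suc i) (Suc n) = qbinom_coeff q i (Suc n) - qbinom_coeff q i n / q ^ i"
proof -
  define a where "a = q powi (- int i)"
  have a: "a = 1 / q ^ i" "q powi (- int (Suc i)) = a / q"
    using assms(1) power_int_minus[of q "int i"] power_int_minus[of q "int (Suc i)"]
    by (simp_all only: a_def power_int_of_nat) (simp_all add: divide_simps)
  have ainv: "inverse (q ^ i) = a"
    by (simp add: a inverse_eq_divide)
  have nz: "qpoch q q n \<noteq> 0" "1 - q * q ^ n \<noteq> 0"
    using assms(2)[of n] assms(2)[of "Suc n"] by (auto simp: qpoch_Suc)
  have "qpoch (a / q) q (Suc n) = (1 - a / q) * qpoch a q n"
    using assms(1) by (simp add: qpoch_Suc_left)
  moreover have "(1 - a / q) * A * (q * Q) / (W * R) =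
      A * (1 - a * Q) * (q * Q) / (W * R) - A * Q / W * a"
    if "W \<noteq> 0" "R \<noteq> 0" "R = 1 - q * Q" for A Q W R
    using that(1,2) assms(1) by (simp add: divide_simps) (use that(3) in algebra)
  ultimately show ?thesis
    unfolding qbinom_coeff_def a(2) a_def[symmetric]
    using nz by (simp only: qpoch_Suc divide_inverse[of _ "q ^ i"] ainv power_Suc) blast
qed

text \<open>
  The quotients \<open>(b;q)\<^sub>i / (b;q)\<^sub>n\<close> are written as \<open>(b q\<^sup>n;q)\<^sub>i\<^sub>-\<^sub>n\<close>, which also makes sense when \<open>(b;q)\<^sub>n = 0\<close>.
  This covers \<open>h\<^sup>\<bottom>\<^sub>D\<^sub>-\<^sub>1\<close>, where only the top term survives and yields the product in its definition.
\<close>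

definition cdq_coeff :: "complex \<Rightarrow> complex \<Rightarrow> complex \<Rightarrow> complex \<Rightarrow> nat \<Rightarrow> nat \<Rightarrow> complex" where
  "cdq_coeff q t B C i n =
     qbinom_coeff q i n * qpoch (t * B * q ^ n) q (i - n) * qpoch (t * C * q ^ n) q (i - n) / t ^ i"

definition aw_basis :: "complex \<Rightarrow> complex \<Rightarrow> nat \<Rightarrow> laurent_poly" where
  "aw_basis q t n = qpoch (Const t * zeta_inv) (Const q) n * qpoch (Const t * zeta) (Const q) n"

text \<open>Splitting off the factors with index 0 shifts t to qt and produces the quadratic of
  \<open>cdq_hahn_times_quadratic\<close>.\<close>

lemma aw_basis_Suc:
  "aw_basis q t (Suc n) =
     (1 + (Const t)\<^sup>2 - Const t * (zeta + zeta_inv)) * aw_basis q (q * t) n"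
proof -
  have "1 + (Const t)\<^sup>2 - Const t * (zeta + zeta_inv) =
    (1 - Const t * zeta_inv) * (1 - Const t * zeta)"
    using zeta_mult_zeta_inv by algebra
  then show ?thesis
    by (simp only: aw_basis_def qpoch_Suc_left Const_mult) (simp only: mult_ac)
qed

lemma cdq_coeff_Suc_0:
  assumes "t \<noteq> 0"
  shows "t * cdq_coeff q t B C (Suc i) 0 =
    (1 - t * B * q ^ i) * (1 - t * C * q ^ i) * cdq_coeff q t B C i 0"
  using assms by (simp add: cdq_coeff_def qbinom_coeff_def qpoch_Suc)

lemma cdq_coeff_eq_0: "q \<noteq> 0 \<Longrightarrow> cdq_coeff q t B C i (Suc i) = 0"
  by (simp add: cdq_coeff_def qbinom_coeff_def qpoch_neg_power_eq_0)

text \<open>\<open>cdq_hahn_times_quadratic\<close> read off at a single basis element. For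
  \<open>n < i\<close> all terms share their remaining Pochhammer factors, and the q-Pascal rule is
  left.\<close>

lemma cdq_coeff_Suc_Suc:
  assumes "q \<noteq> 0" "\<And>n. qpoch q q n \<noteq> 0" "t \<noteq> 0" "n \<le> i"
  shows "t * cdq_coeff q t B C (Suc i) (Suc n) =
    (1 - t * B * q ^ i) * (1 - t * C * q ^ i) * cdq_coeff q t B C i (Suc n)
    - cdq_coeff q (q * t) B C i n"
\<comment> \<open>At \<open>n = i\<close> the natural difference \<open>i - Suc n\<close> truncates
  to 0, but its term carries \<open>qbinom_coeff q i (Suc i) = 0\<close>.\<close>
proof (cases "n = i")
  case True
  have "qbinom_coeff q i (Suc i) = 0"
    using assms(1) by (simp add: qbinom_coeff_def qpoch_neg_power_eq_0)
  then show ?thesis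
    unfolding True cdq_coeff_def qbinom_coeff_Suc[OF assms(1,2)] power_mult_distrib power_Suc
    using assms(1,3) by simp
next
  case False
  then obtain k where k: "i = Suc n + k"
    using assms(4) less_imp_Suc_add[of n i] by auto
  have q: "q * t * B * q ^ n = t * B * q ^ Suc n" "q * t * C * q ^ n = t * C * q ^ Suc n" for B C
    by (simp_all add: ac_simps)
  have r: "t * B * q ^ Suc n * q ^ k = t * B * q ^ i" for B
    by (simp add: k power_add ac_simps)
  have s: "Suc i - Suc n = Suc k" "i - Suc n = k" "i - n = Suc k"
    using k by simp_all
  have aux: "t * ((G1 - G0 / Q) * (U * u) * (V * v) / (t * T)) =
      u * v * (G1 * U * V / T) - G0 * (U * u) * (V * v) / (Q * T)"
    if "Q \<noteq> 0" "T \<noteq> 0" for Q T G1 G0 U V u v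
    using that assms(3) by (simp add: field_simps)
  show ?thesis
    unfolding cdq_coeff_def s q qpoch_Suc r qbinom_coeff_Suc[OF assms(1,2)]
    unfolding power_mult_distrib power_Suc
    using aux[of "q ^ i" "t ^ i" "qbinom_coeff q i (Suc n)" "qbinom_coeff q i n"] assms(1,3) by simp
qed

text \<open>Both sides start at 1 and obey the quadratic relation, which gives index i + 1 at t from
  index i at t and at qt. Hence the induction keeps t arbitrary.\<close>

lemma cdq_hahn_series:
  assumes "q \<noteq> 0" "\<And>n. qpoch q q n \<noteq> 0" "t \<noteq> 0"
  shows "(\<Sum>n\<le>i. Const (cdq_coeff q t B C i n) * aw_basis q t n) =
    cdq_hahn (Const q) (zeta + zeta_inv) (Const t) (Const B) (Const C) i"
  using assms(3)
proof (induction i arbitrary: t)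
  case 0
  show ?case by (simp add: cdq_coeff_def qbinom_coeff_def aw_basis_def)
next
  case (Suc i)
  define u where "u = (1 - t * B * q ^ i) * (1 - t * C * q ^ i)"
  define Y where "Y = 1 + (Const t)\<^sup>2 - Const t * (zeta + zeta_inv)"
  let ?P = "\<lambda>t. cdq_hahn (Const q) (zeta + zeta_inv) (Const t) (Const B) (Const C)"
  let ?c = "\<lambda>t. cdq_coeff q t B C" and ?b = "aw_basis q"
  have c0: "t * ?c t (Suc i) 0 = u * ?c t i 0"
    unfolding u_def using Suc.prems by (rule cdq_coeff_Suc_0)
  have cs: "t * ?c t (Suc i) (Suc n) = u * ?c t i (Suc n) - ?c (q * t) i n" if "n \<le> i" for n
    unfolding u_def using assms(1,2) Suc.prems that by (rule cdq_coeff_Suc_Suc)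
  have quad: "Y * ?P (q * t) i = Const u * ?P t i - Const t * ?P t (Suc i)"
    unfolding u_def Y_def Const_mult Const_diff Const_power Const_1
    by (rule cdq_hahn_times_quadratic)
  have "Const t * (\<Sum>n\<le>Suc i. Const (?c t (Suc i) n) * ?b t n) =
      Const (t * ?c t (Suc i) 0) * ?b t 0 + (\<Sum>n\<le>i. Const (t * ?c t (Suc i) (Suc n)) * ?b t (Suc n))"
    by (simp only: sum.atMost_Suc_shift distrib_left sum_distrib_left Const_mult mult.assoc)
  also have "\<dots> = Const u * (Const (?c t i 0) * ?b t 0) +
      (\<Sum>n\<le>i. Const u * (Const (?c t i (Suc n)) * ?b t (Suc n))
          - Y * (Const (?c (q * t) i n) * ?b (q * t) n))"
    by (intro arg_cong2[where f = "(+)"] sum.cong refl)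
      (simp_all only: c0 cs atMost_iff Const_mult Const_diff aw_basis_Suc Y_def[symmetric]
        left_diff_distrib right_diff_distrib ac_simps)
  also have "\<dots> = Const u * (\<Sum>n\<le>Suc i. Const (?c t i n) * ?b t n)
      - Y * (\<Sum>n\<le>i. Const (?c (q * t) i n) * ?b (q * t) n)"
    by (simp only: sum.atMost_Suc_shift sum_subtractf sum_distrib_left distrib_left add_diff_eq)
  also have "\<dots> = Const u * ?P t i - Y * ?P (q * t) i"
    using Suc.IH[OF Suc.prems] Suc.IH[of "q * t"] Suc.prems assms(1)
    by (simp add: cdq_coeff_eq_0[OF assms(1)])
  also have "\<dots> = Const t * ?P t (Suc i)"
    using quad by simp
  finally show ?case
    using Suc.prems by (simp only: mult_cancel_left Const_eq_0_iff simp_thms)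
qed

section \<open>Extension to integer indices; hypergeometric and product forms\<close>

definition cdq_laurent :: "complex \<Rightarrow> complex \<Rightarrow> complex \<Rightarrow> complex \<Rightarrow> int \<Rightarrow> laurent_poly" where
  "cdq_laurent q t B C j = (if j < 0 then 0
     else cdq_hahn (Const q) (zeta + zeta_inv) (Const t) (Const B) (Const C) (nat j))"

lemma cdq_laurent_of_nat:
  "cdq_laurent q t B C (int n) = cdq_hahn (Const q) (zeta + zeta_inv) (Const t) (Const B) (Const C) n"
  by (simp add: cdq_laurent_def)

lemma cdq_laurent_neg [simp]: "j < 0 \<Longrightarrow> cdq_laurent q t B C j = 0"
  by (simp add: cdq_laurent_def)

lemma cdq_laurent_commute: "cdq_laurent q t B C j = cdq_laurent q C B t j"
  by (simp add: cdq_laurent_def cdq_hahn_commute[of _ _ "Const t"])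

lemmas Const_hom = Const_add Const_diff Const_mult Const_power Const_1

lemma int_nonneg_cases:
  assumes "0 \<le> (j::int)"
  obtains "j = 0" | m where "j = int (Suc m)"
  using assms by (metis nonneg_int_cases not0_implies_Suc of_nat_0)

text \<open>The value 0 at negative indices is consistent here: the last coefficient contains
  \<open>1 - I\<close>, which vanishes at \<open>j = 0\<close>.\<close>

lemma cdq_laurent_recurrence:
  assumes "q \<noteq> 0" "0 \<le> j" and I: "I = q powi j"
  shows "(zeta + zeta_inv) * cdq_laurent q t B C j = cdq_laurent q t B C (j + 1)
    + Const ((t + B + C) * I + t * B * C * (I / q * (1 - I) - I\<^sup>2)) * cdq_laurent q t B C j
    + Const ((1 - I) * (1 - B * C * I / q) * (1 - t * B * I / q) * (1 - t * C * I / q))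
      * cdq_laurent q t B C (j - 1)"
  using assms(2)
proof (cases rule: int_nonneg_cases)
  case 1
  then show ?thesis
    using I cdq_laurent_of_nat[of q t B C 0] cdq_laurent_of_nat[of q t B C 1]
    by (simp add: Const_hom Const_uminus algebra_simps)
next
  case (2 m)
  have I: "I = q ^ Suc m" "I / q = q ^ m"
    using assms(1) unfolding I 2 power_int_of_nat by simp_all
  have j: "j + 1 = int (Suc (Suc m))" "j - 1 = int m" "j = int (Suc m)"
    using 2 by simp_all
  show ?thesis
    unfolding j(1,2) unfolding j(3) times_divide_eq_right[symmetric] I(2)
    unfolding I(1) cdq_laurent_of_nat cdq_hahn.simps(3) Const_hom
    by (simp only: left_diff_distrib) simp
qed

lemma cdq_laurent_shift:
  assumes "q \<noteq> 0" "0 \<le> j" and I: "I = q powi j"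
  shows "cdq_laurent q t B C j = cdq_laurent q (q * t) B C j
    - Const (t * (1 - I) * (1 - B * C * I / q)) * cdq_laurent q (q * t) B C (j - 1)"
  using assms(2)
proof (cases rule: int_nonneg_cases)
  case 1
  then show ?thesis
    using I by (simp add: cdq_laurent_def)
next
  case (2 m)
  have I: "I = q ^ Suc m" "I / q = q ^ m"
    using assms(1) unfolding I 2 power_int_of_nat by simp_all
  have j: "j - 1 = int m" "j = int (Suc m)"
    using 2 by simp_all
  show ?thesis
    unfolding j(1) unfolding j(2) times_divide_eq_right[symmetric] I(2)
    unfolding I(1) cdq_laurent_of_nat Const_hom
    by (rule cdq_hahn_shift)
qed

lemma cdq_laurent_times_quadratic:
  assumes "0 \<le> j" and I: "I = q powi j"
  shows "(1 + (Const t)\<^sup>2 - Const t * (zeta + zeta_inv)) * cdq_laurent q (q * t) B C j =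
    Const ((1 - t * B * I) * (1 - t * C * I)) * cdq_laurent q t B C j
        - Const t * cdq_laurent q t B C (j + 1)"
proof -
  obtain n where n: "j = int n"
    using assms(1) nonneg_int_cases by blast
  have j: "j + 1 = int (Suc n)" "j = int n" "I = q ^ n"
    using n I by simp_all
  show ?thesis
    unfolding j(1) unfolding j(2,3) cdq_laurent_of_nat Const_hom by (rule cdq_hahn_times_quadratic)
qed

text \<open>As the lower Pochhammer factors do not vanish, the prefactor absorbs the denominators of
  the series term by term, which yields \<open>cdq_coeff\<close>.\<close>

lemma phi32_eq_cdq_laurent:
  assumes "q \<noteq> 0" "\<And>n. qpoch q q n \<noteq> 0" "t \<noteq> 0"
    and nz: "\<And>n. n \<le> i \<Longrightarrow> qpoch (t * B) q n \<noteq> 0" "\<And>n. n \<le> i \<Longrightarrow> qpoch (t * C) q n \<noteq> 0"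
  shows "Const (qpoch (t * B) q i * qpoch (t * C) q i / t ^ i)
    * phi32 (q powi (- int i)) (Const t * zeta_inv) (Const t * zeta) (t * B) (t * C) q q =
    cdq_laurent q t B C (int i)"
proof -
  have shift: "qpoch (a * q ^ n) q (i - n) = qpoch a q i / qpoch a q n"
    if "n \<le> i" "qpoch a q n \<noteq> 0" for a n
    using that qpoch_add[of a q n "i - n"] by simp
  have "cdq_coeff q t B C i n = qpoch (t * B) q i * qpoch (t * C) q i / t ^ i *
      (qpoch (q powi (- int i)) q n / (qpoch (t * B) q n * qpoch (t * C) q n)
        * (q ^ n / qpoch q q n))" if "n \<le> i" for n
    unfolding cdq_coeff_def qbinom_coeff_def
    unfolding shift[OF that nz(1)[OF that]] shift[OF that nz(2)[OF that]]
    by (simp add: mult_ac)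
  then show ?thesis
    unfolding phi32_terminates[OF assms(1)] cdq_laurent_of_nat cdq_hahn_series[OF assms(1-3), symmetric]
      sum_distrib_left
    by (intro sum.cong refl) (simp only: atMost_iff aw_basis_def Const_mult mult.assoc)
qed

text \<open>For a = t q^i, each step contributes -(1/a)(1 - a/\<zeta>)(1 - a\<zeta>) = \<zeta> +
  1/\<zeta> - a - 1/a. On the diagonal the q-Pascal rule keeps only its second term, which supplies
  -1/a.\<close>

lemma qbinom_coeff_diag_aw_basis:
  assumes "q \<noteq> 0" "\<And>n. qpoch q q n \<noteq> 0" "t \<noteq> 0"
  shows "Const (qbinom_coeff q i i / t ^ i) * aw_basis q t i =
    (\<Prod>j<i. zeta + zeta_inv - Const (t * q ^ j) - Const (inverse (t * q ^ j)))"
proof (induction i)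
  case 0
  show ?case by (simp add: qbinom_coeff_def aw_basis_def)
next
  case (Suc i)
  define a where "a = t * q ^ i"
  have a: "a \<noteq> 0" using assms by (simp add: a_def)
  have "qbinom_coeff q i (Suc i) = 0"
    using assms(1) by (simp add: qbinom_coeff_def qpoch_neg_power_eq_0)
  then have 1: "qbinom_coeff q (Suc i) (Suc i) / t ^ Suc i = qbinom_coeff q i i / t ^ i * (- inverse a)"
    unfolding qbinom_coeff_Suc[OF assms(1,2)] by (simp add: a_def field_simps)
  have "Const a * Const (inverse a) = 1"
    using a by (simp flip: Const_mult)
  then have 2: "- Const (inverse a) * ((1 - Const a * zeta_inv) * (1 - Const a * zeta)) =
      zeta + zeta_inv - Const a - Const (inverse a)"
    using zeta_mult_zeta_inv by algebra
  have "aw_basis q t (Suc i) = aw_basis q t i * ((1 - Const a * zeta_inv) * (1 - Const a * zeta))"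
    by (simp add: aw_basis_def qpoch_Suc a_def Const_hom ac_simps)
  then have "Const (qbinom_coeff q (Suc i) (Suc i) / t ^ Suc i) * aw_basis q t (Suc i) =
    (Const (qbinom_coeff q i i / t ^ i) * aw_basis q t i)
    * (- Const (inverse a) * ((1 - Const a * zeta_inv) * (1 - Const a * zeta)))"
    unfolding 1 by (simp only: Const_mult Const_uminus mult_ac)
  also have "\<dots> = (\<Prod>j<Suc i. zeta + zeta_inv - Const (t * q ^ j) - Const (inverse (t * q ^ j)))"
    unfolding 2 Suc by (simp add: a_def)
  finally show ?case .
qed

section \<open>Specialisation to the dual q-Hahn parameters\<close>

locale dual_q_hahn =
  fixes q \<tau> :: complex and N D :: int
  assumes q_nz: "q \<noteq> 0"
    and powi_neq_1: "k \<noteq> 0 \<Longrightarrow> q powi k \<noteq> 1"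
    and tau_sq: "\<tau>\<^sup>2 = q powi (- N - 1)"
    and D_ge: "2 \<le> D"
    and N_ge: "2 * D \<le> N"
begin

definition "E = q powi D"
definition "B = q * E * \<tau>"
definition "C = 1 / (E * \<tau>)"

text \<open>
  Indexing by all integers lets the boundary polynomials \<open>\<ell>\<^sup>\<plusminus>\<^sub>-\<^sub>1\<close> and \<open>\<ell>\<^sup>\<plusminus>\<^sub>D\<close> obey the same formulas
  as the others.
\<close>

definition "HH j = cdq_laurent q \<tau> B C j"
definition "RR j = cdq_laurent q (q * \<tau>) B (q * C) j"
text \<open>The index shift aligns \<open>GG j\<close> with \<open>HH j\<close>: the two occur
  together in \<open>ell_minus\<close> at j and in \<open>ell_plus\<close> at j - 1.\<close>

definition "GG j = pperp q \<tau> D * RR (j - 1)"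

lemma tau_nz [simp]: "\<tau> \<noteq> 0"
  using tau_sq q_nz by auto

lemma E_nz [simp]: "E \<noteq> 0"
  using q_nz by (simp add: E_def)

lemma E_neq_1 [simp]: "E \<noteq> 1"
  using powi_neq_1 D_ge by (simp add: E_def)

text \<open>The factors are 1 - q^m with k \<le> m < k + n, and the hypothesis keeps m = 0 out of
  that range.\<close>

lemma qpoch_powi_nz:
  assumes "n = 0 \<or> 0 < k \<or> k + int n \<le> 0"
  shows "qpoch (q powi k) q n \<noteq> 0"
proof -
  have "1 - q powi k * q ^ j \<noteq> 0" if "j < n" for j
    using that assms powi_neq_1[of "k + int j"] q_nz by (auto simp: power_int_add)
  then show ?thesis
    unfolding qpoch_def by simp
qed

lemma qpoch_q_nz: "qpoch q q n \<noteq> 0"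
  using qpoch_powi_nz[of n 1] by simp

lemma tB: "\<tau> * B = q powi (D - N)"
proof -
  have "\<tau> * B = q * E * q powi (- N - 1)"
    by (simp add: B_def power2_eq_square flip: tau_sq)
  also have "\<dots> = q powi (1 + D + (- N - 1))"
    using q_nz power_int_add[of q "1 + D" "- N - 1"] power_int_add[of q 1 D] by (simp add: E_def)
  finally show ?thesis by simp
qed

lemma tC: "\<tau> * C = q powi (- D)"
  by (simp add: C_def E_def power_int_minus divide_inverse)

lemma h_eq:
  assumes "0 \<le> j" "j \<le> D"
  shows "h q \<tau> N D j = HH j"
proof -
  obtain i where i: "j = int i"
    using assms(1) nonneg_int_cases by blast
  have "qpoch (\<tau> * B) q n \<noteq> 0" "qpoch (\<tau> * C) q n \<noteq> 0" if "n \<le> i" for n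
    unfolding tB tC using that assms N_ge i by (auto intro!: qpoch_powi_nz)
  from phi32_eq_cdq_laurent[OF q_nz qpoch_q_nz tau_nz this] show ?thesis
    unfolding h_def HH_def i tB tC by (simp add: power_int_of_nat)
qed

text \<open>For n \<le> D - 2 the exponents in (q^(2-D);q)_n stay negative. For n = D - 1 they reach
  0, so the top index is treated separately.\<close>

lemma hperp_eq_aux:
  assumes "0 \<le> j" "j \<le> D - 2"
  shows "hperp q \<tau> N D j = RR j"
proof -
  obtain i where i: "j = int i"
    using assms(1) nonneg_int_cases by blast
  have B: "q * \<tau> * B = q powi (D - N + 1)"
    using q_nz tB by (simp add: power_int_add mult.assoc mult.commute)
  have C: "q * \<tau> * (q * C) = q powi (2 - D)"
    using q_nz tC power_int_add[of q 2 "- D"] by (simp add: power2_eq_square mult.assoc mult.left_commute)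
  have "qpoch (q * \<tau> * B) q n \<noteq> 0" "qpoch (q * \<tau> * (q * C)) q n \<noteq> 0" if "n \<le> i" for n
    unfolding B C using that assms N_ge i by (auto intro!: qpoch_powi_nz)
  from phi32_eq_cdq_laurent[OF q_nz qpoch_q_nz _ this] show ?thesis
    using assms q_nz unfolding hperp_def RR_def i B C by (simp add: power_int_of_nat mult.commute)
qed

lemma hperp_eq_top: "hperp q \<tau> N D (D - 1) = RR (D - 1)"
proof -
  define d where "d = nat (D - 1)"
  have d: "D - 1 = int d" "D = int d + 1"
    using D_ge by (simp_all add: d_def)
  let ?c = "cdq_coeff q (q * \<tau>) B (q * C) d"
  have C: "q * \<tau> * (q * C) = q powi (1 - int d)"
    using q_nz tC power_int_add[of q 2 "- D"]
    by (simp add: d(2) power2_eq_square mult.assoc mult.left_commute)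
  \<comment> \<open>The last factor has exponent 1 - d + n + (d - n - 1) = 0, so only the term
    \<open>n = d\<close> of the series survives.\<close>
  have "qpoch (q * \<tau> * (q * C) * q ^ n) q (d - n) = 0" if "n < d" for n
  proof -
    have "1 - q * \<tau> * (q * C) * q ^ n * q ^ (d - Suc n) =
        1 - q powi (1 - int d + int n + int (d - Suc n))"
      unfolding C by (simp only: power_int_add power_int_of_nat q_nz simp_thms)
    also have "\<dots> = 0"
      using that by simp
    finally show ?thesis
      unfolding qpoch_def using that by (intro prod_zero bexI[of _ "d - Suc n"]) auto
  qed
  then have "?c n = 0" if "n < d" for n
    using that by (simp add: cdq_coeff_def)
  then have "(\<Sum>n\<le>d. Const (?c n) * aw_basis q (q * \<tau>) n) = (\<Sum>n\<in>{d}. Const (?c n) * aw_basis q (q * \<tau>) n)"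
    by (intro sum.mono_neutral_right) auto
  then have "RR (D - 1) = Const (?c d) * aw_basis q (q * \<tau>) d"
    using cdq_hahn_series[OF q_nz qpoch_q_nz, of "q * \<tau>" B "q * C" d] q_nz
    unfolding RR_def d(1) cdq_laurent_of_nat by simp
  also have "?c d = qbinom_coeff q d d / (q * \<tau>) ^ d"
    by (simp add: cdq_coeff_def)
  also have "Const \<dots> * aw_basis q (q * \<tau>) d =
    (\<Prod>j<d. zeta + zeta_inv - Const (q * \<tau> * q ^ j) - Const (inverse (q * \<tau> * q ^ j)))"
    using q_nz by (intro qbinom_coeff_diag_aw_basis) (simp_all add: qpoch_q_nz)
  also have "\<dots> = (\<Prod>j\<in>{1..D - 1}. zeta + zeta_inv - Const (\<tau> * q powi j)
      - Const (inverse \<tau> * q powi (- j)))"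
  proof (rule prod.reindex_bij_witness[of _ "\<lambda>j. nat (j - 1)" "\<lambda>j. int j + 1"])
    fix j
    assume "j \<in> {..<d}"
    have "q powi (int j + 1) = q * q ^ j" "q powi (- (int j + 1)) = inverse (q * q ^ j)"
      using q_nz unfolding power_int_minus by (simp_all add: power_int_add)
    then show "zeta + zeta_inv - Const (\<tau> * q powi (int j + 1))
        - Const (inverse \<tau> * q powi (- (int j + 1))) =
      zeta + zeta_inv - Const (q * \<tau> * q ^ j) - Const (inverse (q * \<tau> * q ^ j))"
      by (simp add: mult_ac)
  qed (auto simp: d_def)
  finally show ?thesis
    using D_ge by (simp add: hperp_def)
qed

lemma hperp_eq:
  assumes "j \<le> D - 1"
  shows "hperp q \<tau> N D j = RR j"
proof -
  consider "j < 0" | "0 \<le> j" "j \<le> D - 2" | "j = D - 1"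
    using assms by linarith
  then show ?thesis
    using hperp_eq_aux hperp_eq_top D_ge by cases (auto simp: hperp_def RR_def)
qed

lemma pperp_eq: "pperp q \<tau> D = (1 - Const \<tau> * zeta_inv) * (zeta - Const C)"
proof -
  have C: "inverse \<tau> * q powi (- D) = C"
    by (simp add: C_def E_def power_int_minus divide_inverse)
  show ?thesis
    unfolding pperp_def C using zeta_mult_zeta_inv by algebra
qed

lemma zeta_pperp: "Const (1 - \<tau> * C) * zeta =
    pperp q \<tau> D - Const (\<tau> * C) * (zeta + zeta_inv) + Const (\<tau> + C)"
  unfolding pperp_eq Const_hom using zeta_mult_zeta_inv by algebra

text \<open>Multiply \<open>zeta_pperp\<close> by p(\<zeta>), where p is \<open>pperp\<close>, and
  eliminate its square by p(\<zeta>) + p(1/\<zeta>) = (1 + \<tau>C)X - 2(\<tau> + C). The product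
  p(\<zeta>) p(1/\<zeta>) is the product of the two quadratics.\<close>

lemma zeta_pperp_sq: "Const (1 - \<tau> * C) * (zeta * pperp q \<tau> D) =
    (zeta + zeta_inv) * pperp q \<tau> D - Const (\<tau> + C) * pperp q \<tau> D
    - (1 + (Const \<tau>)\<^sup>2 - Const \<tau> * (zeta + zeta_inv)) * (1 + (Const C)\<^sup>2 - Const C * (zeta + zeta_inv))"
  unfolding pperp_eq Const_hom using zeta_mult_zeta_inv by algebra

section \<open>Contiguous relations with coefficients expressed through \<open>I\<close>, a power of
  q\<close>

lemma BC: "B * C = q"
  by (simp add: B_def C_def)

text \<open>\<open>bH\<close>, \<open>cH\<close> are the recurrence coefficients of
  \<open>HH\<close> at j and \<open>bG\<close>, \<open>cG\<close> those of \<open>RR\<close> at j -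
  1, for \<open>I\<close> = q^j. \<open>k1\<close>, \<open>k2\<close> belong to the shifts of \<tau>
  and C; \<open>uG\<close>, \<open>vG\<close> to the quadratic relations at \<tau> and C. As BC = q,
  the factor 1 - BCI/q becomes 1 - I, whence the squares.\<close>

definition "bH I = (\<tau> + q * E * \<tau> + 1 / (E * \<tau>)) * I + q * \<tau> * (I / q * (1 - I) - I\<^sup>2)"
definition "cH I = (1 - I)\<^sup>2 * (1 - E * \<tau>\<^sup>2 * I) * (1 - I / (q * E))"
definition "k1 I = - \<tau> * (1 - I)\<^sup>2"
definition "k2 I = - (C * (1 - I) * (1 - q * E * \<tau>\<^sup>2 * I))"
definition "bG I = (q * \<tau> + q * E * \<tau> + q / (E * \<tau>)) * (I / q)
    + q ^ 3 * \<tau> * (I / q / q * (1 - I / q) - (I / q)\<^sup>2)"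
definition "cG I = (1 - I / q) * (1 - I) * (1 - E * \<tau>\<^sup>2 * I) * (1 - I / E)"
definition "uG I = (1 - E * \<tau>\<^sup>2 * I) * (1 - I / (q * E))"
definition "vG I = (1 - I) * (1 - I / E)"

lemma X_HH:
  assumes "0 \<le> j" "I = q powi j"
  shows "(zeta + zeta_inv) * HH j = HH (j + 1) + Const (bH I) * HH j + Const (cH I) * HH (j - 1)"
proof -
  have 1: "(\<tau> + B + C) * I + \<tau> * B * C * (I / q * (1 - I) - I\<^sup>2) = bH I"
    using BC by (simp add: bH_def B_def C_def)
  have 2: "(1 - I) * (1 - B * C * I / q) * (1 - \<tau> * B * I / q) * (1 - \<tau> * C * I / q) = cH I"
    using q_nz unfolding BC by (simp add: cH_def B_def C_def power2_eq_square mult_ac)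
  show ?thesis
    using cdq_laurent_recurrence[OF q_nz assms, of \<tau> B C] unfolding HH_def 1 2 .
qed

lemma X_RR:
  assumes "1 \<le> j" "I = q powi j"
  shows "(zeta + zeta_inv) * RR (j - 1) = RR j + Const (bG I) * RR (j - 1) + Const (cG I) * RR (j - 2)"
proof -
  have I: "I / q = q powi (j - 1)"
    using assms q_nz by (simp add: power_int_diff)
  have 1: "(q * \<tau> + B + q * C) * (I / q)
      + q * \<tau> * B * (q * C) * (I / q / q * (1 - I / q) - (I / q)\<^sup>2) = bG I"
    by (simp add: bG_def B_def C_def power3_eq_cube)
  have 2: "(1 - I / q) * (1 - B * (q * C) * (I / q) / q) * (1 - q * \<tau> * B * (I / q) / q)
      * (1 - q * \<tau> * (q * C) * (I / q) / q) = cG I"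
    using q_nz by (simp add: cG_def B_def C_def power2_eq_square mult_ac)
  show ?thesis
    using cdq_laurent_recurrence[OF q_nz _ I, of "q * \<tau>" B "q * C"] assms(1) unfolding RR_def 1 2 by simp
qed

text \<open>Two shifts in turn: \<tau> to q\<tau> directly, then C to qC by symmetry.
  \<open>S\<close> is the intermediate family with parameters q\<tau>, B, C.\<close>

lemma HH_RR:
  assumes "0 \<le> j" and I: "I = q powi j"
  shows "HH j = RR j + Const (k1 I + k2 I) * RR (j - 1) + Const (k1 I * k2 (I / q)) * RR (j - 2)"
proof -
  define S where "S j = cdq_laurent q (q * \<tau>) B C j" for j
  have k1: "- (\<tau> * (1 - I) * (1 - B * C * I / q)) = k1 I" for I
    using q_nz by (simp add: BC k1_def power2_eq_square)
  have k2: "- (C * (1 - I) * (1 - B * (q * \<tau>) * I / q)) = k2 I" for I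
    using q_nz by (simp add: k2_def B_def power2_eq_square mult_ac)
  have 1: "HH j = S j + Const (k1 I) * S (j - 1)"
    using cdq_laurent_shift[OF q_nz assms, of \<tau> B C] unfolding HH_def S_def k1[symmetric] Const_uminus by simp
  have 2: "S j = RR j + Const (k2 I) * RR (j - 1)" if "0 \<le> j" "I = q powi j" for j I
    using cdq_laurent_shift[OF q_nz that, of C B "q * \<tau>"]
    unfolding S_def RR_def k2[symmetric] Const_uminus cdq_laurent_commute[of q "q * \<tau>" B] by simp
  have "Const (k1 I) * S (j - 1) = Const (k1 I) * RR (j - 1) + Const (k1 I * k2 (I / q)) * RR (j - 2)"
  proof (cases "j = 0")
    case True
    then show ?thesis using I by (simp add: S_def RR_def)
  next
    case False
    then show ?thesis
      using 2[of "j - 1" "I / q"] assms q_nz by (simp add: power_int_diff Const_mult algebra_simps)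
  qed
  then show ?thesis
    unfolding 1 2[OF assms] Const_add by (simp add: algebra_simps)
qed

text \<open>The factor on the left is \<open>pperp\<close> at \<zeta> times \<open>pperp\<close> at
  1/\<zeta>. The quadratic at C takes qC back to C, and then the one at \<tau> takes q\<tau> back to
  \<tau>.\<close>

lemma quadratics_RR:
  assumes "1 \<le> j" and I: "I = q powi j"
  shows "(1 + (Const \<tau>)\<^sup>2 - Const \<tau> * (zeta + zeta_inv)) *
      ((1 + (Const C)\<^sup>2 - Const C * (zeta + zeta_inv)) * RR (j - 1)) =
    Const (1 / E) * HH (j + 1) - Const (C * uG (q * I) + \<tau> * vG I) * HH j
        + Const (vG I * uG I) * HH (j - 1)"
proof -
  define S where "S j = cdq_laurent q (q * \<tau>) B C j" for j
  define Y where "Y = 1 + (Const \<tau>)\<^sup>2 - Const \<tau> * (zeta + zeta_inv)"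
  have I': "I / q = q powi (j - 1)"
    using assms q_nz by (simp add: power_int_diff)
  have u: "(1 - \<tau> * B * (I / q)) * (1 - \<tau> * C * (I / q)) = uG I" for I
    using q_nz by (simp add: uG_def B_def C_def power2_eq_square mult_ac)
  have v: "(1 - C * B * (I / q)) * (1 - C * (q * \<tau>) * (I / q)) = vG I"
    using q_nz by (simp add: vG_def B_def C_def)
  have 1: "(1 + (Const C)\<^sup>2 - Const C * (zeta + zeta_inv)) * RR (j - 1) =
      Const (vG I) * S (j - 1) - Const C * S j"
    using cdq_laurent_times_quadratic[OF _ I', of C B "q * \<tau>"] assms(1)
    unfolding v S_def RR_def by (simp add: cdq_laurent_commute[of q C] cdq_laurent_commute[of q "q * C"])
  have 2: "Y * S j = Const (uG (q * I)) * HH j - Const \<tau> * HH (j + 1)"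
    using cdq_laurent_times_quadratic[OF _ I, of \<tau> B C] u[of "q * I"] assms(1) q_nz
    unfolding S_def HH_def Y_def by simp
  have 3: "Y * S (j - 1) = Const (uG I) * HH (j - 1) - Const \<tau> * HH j"
    using cdq_laurent_times_quadratic[OF _ I', of \<tau> B C] assms(1)
    unfolding S_def HH_def Y_def u by simp
  have tC: "1 / E = \<tau> * C"
    by (simp add: C_def)
  have "Y * (Const (vG I) * S (j - 1) - Const C * S j) =
      Const (vG I) * (Y * S (j - 1)) - Const C * (Y * S j)"
    by (simp add: algebra_simps)
  then show ?thesis
    unfolding 1 Y_def[symmetric] 2 3 tC Const_hom by (simp add: algebra_simps)
qed


section \<open>Multiplication by \<zeta> in terms of \<open>HH\<close> and \<open>GG\<close>\<close>

definition lincomb :: "int \<Rightarrow> complex \<Rightarrow> complex \<Rightarrow> complex \<Rightarrow> complex \<Rightarrow> complex \<Rightarrow> complex \<Rightarrow> laurent_poly" where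
  "lincomb j a b c d e f = Const a * HH (j - 1) + Const b * HH j + Const c * HH (j + 1)
     + Const d * GG (j - 1) + Const e * GG j + Const f * GG (j + 1)"

lemma lincomb_add: "lincomb j a b c d e f + lincomb j a' b' c' d' e' f' =
    lincomb j (a + a') (b + b') (c + c') (d + d') (e + e') (f + f')"
  by (simp add: lincomb_def Const_add algebra_simps)

lemma lincomb_diff: "lincomb j a b c d e f - lincomb j a' b' c' d' e' f' =
    lincomb j (a - a') (b - b') (c - c') (d - d') (e - e') (f - f')"
  by (simp add: lincomb_def Const_diff algebra_simps)

lemma lincomb_scale: "Const x * lincomb j a b c d e f =
    lincomb j (x * a) (x * b) (x * c) (x * d) (x * e) (x * f)"
  by (simp add: lincomb_def Const_mult algebra_simps)

text \<open>\<open>zeta_pperp\<close> times \<open>HH j\<close>, with \<open>HH_RR\<close> for the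
  \<open>pperp\<close> term and the recurrence for the X term. Scaling by E turns 1 - \<tau>C into E
  - 1, since \<tau>C = 1/E.\<close>

lemma zeta_HH:
  assumes "0 \<le> j" and I: "I = q powi j"
  shows "zeta * HH j = Const (1 / (E - 1)) * lincomb j (- cH I) (E * \<tau> + 1 / \<tau> - bH I) (- 1)
    (E * (k1 I * k2 (I / q))) (E * (k1 I + k2 I)) E"
proof -
  have p: "pperp q \<tau> D * HH j = GG (j + 1) + Const (k1 I + k2 I) * GG j
      + Const (k1 I * k2 (I / q)) * GG (j - 1)"
    unfolding HH_RR[OF assms] GG_def by (simp add: algebra_simps)
  have "E * (1 - \<tau> * C) = E - 1" "E * (\<tau> * C) = 1" "E * (\<tau> + C) = E * \<tau> + 1 / \<tau>"
    by (simp_all add: C_def distrib_left right_diff_distrib)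
  then have c: "Const E * Const (1 - \<tau> * C) = Const (E - 1)" "Const E * Const (\<tau> * C) = 1"
    "Const E * Const (\<tau> + C) = Const (E * \<tau> + 1 / \<tau>)"
    by (simp_all flip: Const_mult)
  have "Const (E - 1) * (zeta * HH j) = Const E * (Const (1 - \<tau> * C) * zeta * HH j)"
    unfolding c(1)[symmetric] by (simp only: mult_ac)
  also have "\<dots> = Const E * (pperp q \<tau> D * HH j) - Const E * Const (\<tau> * C) * ((zeta + zeta_inv) * HH j)
      + Const E * Const (\<tau> + C) * HH j"
    unfolding zeta_pperp by (simp only: algebra_simps)
  also have "\<dots> = lincomb j (- cH I) (E * \<tau> + 1 / \<tau> - bH I) (- 1)
    (E * (k1 I * k2 (I / q))) (E * (k1 I + k2 I)) E"
    unfolding c(2,3) p X_HH[OF assms] lincomb_def by (simp add: Const_hom Const_uminus algebra_simps)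
  finally have "Const (1 / (E - 1)) * (Const (E - 1) * (zeta * HH j)) = Const (1 / (E - 1)) * \<dots>"
    by simp
  then show ?thesis
    by (simp flip: mult.assoc Const_mult)
qed

lemma X_HH_lin:
  assumes "0 \<le> j" and I: "I = q powi j"
  shows "(zeta + zeta_inv) * HH j = lincomb j (cH I) (bH I) 1 0 0 0"
  unfolding X_HH[OF assms] lincomb_def by simp

lemma X_GG_lin:
  assumes "1 \<le> j" and I: "I = q powi j"
  shows "(zeta + zeta_inv) * GG j = lincomb j 0 0 0 (cG I) (bG I) 1"
proof -
  have "(zeta + zeta_inv) * GG j = pperp q \<tau> D * ((zeta + zeta_inv) * RR (j - 1))"
    unfolding GG_def by (simp only: mult_ac)
  then show ?thesis
    unfolding X_RR[OF assms] lincomb_def GG_def by (simp add: algebra_simps)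
qed

text \<open>\<open>zeta_pperp_sq\<close> times \<open>RR (j - 1)\<close>; its product of quadratics
  leads back to \<open>HH\<close> through \<open>quadratics_RR\<close>.\<close>

lemma zeta_GG:
  assumes "1 \<le> j" and I: "I = q powi j"
  shows "zeta * GG j = Const (E / (E - 1))
      * lincomb j (- (vG I * uG I)) (C * uG (q * I) + \<tau> * vG I) (- (1 / E))
    (cG I) (bG I - \<tau> - C) 1"
proof -
  have c: "Const (E / (E - 1)) * Const (1 - \<tau> * C) = 1"
    by (simp add: C_def field_simps flip: Const_mult)
  have "Const (1 - \<tau> * C) * (zeta * GG j) = (Const (1 - \<tau> * C) * (zeta * pperp q \<tau> D)) * RR (j - 1)"
    unfolding GG_def by (simp only: mult_ac)
  also have "\<dots> = (zeta + zeta_inv) * GG j - Const (\<tau> + C) * GG j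
     - (1 + (Const \<tau>)\<^sup>2 - Const \<tau> * (zeta + zeta_inv)) *
      ((1 + (Const C)\<^sup>2 - Const C * (zeta + zeta_inv)) * RR (j - 1))"
    unfolding zeta_pperp_sq GG_def by (simp only: left_diff_distrib mult.assoc)
  also have "\<dots> = lincomb j (- (vG I * uG I)) (C * uG (q * I) + \<tau> * vG I) (- (1 / E))
    (cG I) (bG I - \<tau> - C) 1"
    unfolding quadratics_RR[OF assms] X_GG_lin[OF assms] lincomb_def
    by (simp add: Const_add Const_diff Const_uminus algebra_simps)
  finally have "Const (E / (E - 1)) * (Const (1 - \<tau> * C) * (zeta * GG j)) = Const (E / (E - 1)) * \<dots>"
    by simp
  then show ?thesis
    by (simp add: c flip: mult.assoc)
qed

section \<open>The non-symmetric polynomials and their boundary cases in terms of \<open>HH\<close>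
  and \<open>GG\<close>\<close>

definition "nu j = (if j < 0 then 0 else 1 / (\<tau> powi j * (E - 1) * (qpoch q q (nat j))\<^sup>2))"

lemma nu_Suc:
  assumes "0 \<le> j"
  shows "nu (j + 1) = nu j / (\<tau> * (1 - q * q powi j)\<^sup>2)"
proof -
  obtain n where n: "j = int n"
    using assms(1) nonneg_int_cases by blast
  have "nu (int (Suc n)) = nu (int n) / (\<tau> * (1 - q * q ^ n)\<^sup>2)"
    unfolding nu_def power_int_of_nat nat_int qpoch_Suc by (simp add: power_mult_distrib mult_ac)
  then show ?thesis
    unfolding n power_int_of_nat by (simp add: add.commute)
qed

lemma nu_pred:
  assumes "0 \<le> j"
  shows "nu (j - 1) = nu j * \<tau> * (1 - q powi j)\<^sup>2"
proof (cases "j = 0")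
  case False
  have "q * q powi (j - 1) = q powi j"
    using power_int_add[of q 1 "j - 1"] q_nz by simp
  moreover have "1 - q powi j \<noteq> 0"
    using powi_neq_1 False by simp
  ultimately show ?thesis
    using nu_Suc[of "j - 1"] False assms by (simp add: field_simps)
qed (simp add: nu_def)

text \<open>Moving E - q^j inside clears the inner denominator, so the formula also makes sense at j
  = D, where the \<open>HH\<close> term drops out. At j = -1 it gives 0 because \<open>nu\<close>
  does.\<close>

lemma ell_minus_eq:
  assumes "- 1 \<le> j" "j \<le> D"
  shows "ell_minus q \<tau> N D j = Const (nu j)
      * (Const (E - q powi j) * HH j - Const (1 - q powi j) * GG j)"
proof -
  consider "j = - 1" | "0 \<le> j" "j \<le> D - 1" | "j = D"
    using assms by linarith
  then show ?thesis
  proof cases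
    case 1
    then show ?thesis using D_ge by (simp add: ell_minus_def nu_def)
  next
    case 2
    have "q powi (D - j) \<noteq> 1"
      using powi_neq_1 2 by simp
    then have nz: "E - q powi j \<noteq> 0"
      using q_nz by (simp add: E_def power_int_diff)
    have n: "(E - q powi j) / (\<tau> powi j * (E - 1) * (qpoch q q (nat j))\<^sup>2) = nu j * (E - q powi j)"
      using 2 by (simp add: nu_def)
    have "Const (E - q powi j) * Const ((1 - q powi j) / (E - q powi j)) = Const (1 - q powi j)"
      using nz by (simp flip: Const_mult)
    then have "Const (E - q powi j) * (HH j
        - Const ((1 - q powi j) / (E - q powi j)) * pperp q \<tau> D * RR (j - 1))
      = Const (E - q powi j) * HH j - Const (1 - q powi j) * GG j"
      unfolding GG_def by (simp only: right_diff_distrib mult.assoc[symmetric])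
    moreover have "ell_minus q \<tau> N D j = Const (nu j * (E - q powi j)) *
      (HH j - Const ((1 - q powi j) / (E - q powi j)) * pperp q \<tau> D * RR (j - 1))"
      unfolding ell_minus_def E_def[symmetric] n using 2 h_eq[of j] hperp_eq[of "j - 1"] by simp
    ultimately show ?thesis
      by (simp only: Const_mult mult.assoc)
  next
    case 3
    have "1 / (\<tau> powi D * (qpoch q q (nat D))\<^sup>2) = nu D * (E - 1)"
      using D_ge by (simp add: nu_def)
    then have "ell_minus q \<tau> N D D = Const (nu D * (E - 1)) * pperp q \<tau> D * RR (D - 1)"
      using D_ge hperp_eq[of "D - 1"] by (simp add: ell_minus_def)
    then show ?thesis
      unfolding 3 E_def[symmetric] GG_def Const_hom by (simp add: algebra_simps)
  qed
qed

lemma ell_plus_eq_inner: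
  assumes "0 \<le> j" "j \<le> D"
  shows "ell_plus q \<tau> N D (j - 1) = Const (- (nu j * (1 - q powi j))) * (HH j - GG j)"
proof (cases "j = 0")
  case False
  then have "(q powi j - 1) / (\<tau> powi j * (E - 1) * (qpoch q q (nat j))\<^sup>2) = - (nu j * (1 - q powi j))"
    using assms by (simp add: nu_def minus_divide_left)
  then show ?thesis
    using assms False h_eq[of j] hperp_eq[of "j - 1"]
    by (simp add: ell_plus_def E_def[symmetric] GG_def)
qed (use D_ge in \<open>simp add: ell_plus_def\<close>)

text \<open>At I = E the coefficients \<open>vG E\<close>, \<open>uG (q * E)\<close> and
  \<open>cG E\<close> vanish. So \<open>HH (D + 1)\<close> and \<open>GG (D + 1)\<close> are both
  multiples of \<open>pperp\<close> times \<open>RR (D - 1)\<close>, and the difference of their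
  cofactors is the linear factor in the definition of the boundary polynomial.\<close>

lemma ell_plus_top:
  "ell_plus q \<tau> N D D = Const (- (nu (D + 1) * (1 - q powi (D + 1)))) * (HH (D + 1) - GG (D + 1))"
proof -
  define p where "p = pperp q \<tau> D"
  \<comment> \<open>This is \<open>pperp\<close> with \<zeta> replaced by its inverse.\<close>
  define pbar where "pbar = (1 - Const \<tau> * zeta) * (zeta_inv - Const C)"
  define R where "R = RR (D - 1)"
  have D1: "1 \<le> D" using D_ge by simp
  have uv: "uG (q * E) = 0" "vG E = 0"
    using q_nz by (simp_all add: uG_def vG_def)
  have "(1 + (Const \<tau>)\<^sup>2 - Const \<tau> * (zeta + zeta_inv)) *
      ((1 + (Const C)\<^sup>2 - Const C * (zeta + zeta_inv)) * R) = Const (1 / E) * HH (D + 1)"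
    using quadratics_RR[OF D1 E_def] by (simp add: uv R_def)
  moreover have "(1 + (Const \<tau>)\<^sup>2 - Const \<tau> * (zeta + zeta_inv)) *
      ((1 + (Const C)\<^sup>2 - Const C * (zeta + zeta_inv)) * R) = pbar * p * R"
    unfolding p_def pbar_def pperp_eq using zeta_mult_zeta_inv by algebra
  ultimately have "Const E * (pbar * p * R) = Const E * (Const (1 / E) * HH (D + 1))"
    by (simp only:)
  also have "\<dots> = HH (D + 1)"
    by (simp flip: mult.assoc Const_mult)
  finally have "Const E * (pbar * p * R) = HH (D + 1)" .
  moreover have "Const E * Const C * Const \<tau> = 1"
    by (simp add: C_def flip: Const_mult)
  then have "Const E * pbar = Const E * zeta_inv - Const E * Const C - Const E * Const \<tau> + zeta"
    unfolding pbar_def using zeta_mult_zeta_inv by algebra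
  moreover have "GG (D + 1) = p * ((zeta + zeta_inv) * R - Const (bG E) * R)"
    using X_RR[OF D1 E_def] by (simp add: R_def p_def GG_def cG_def)
  moreover have "bG E = E * \<tau> + E * C - (E - 1) * q * E * \<tau>"
    using q_nz by (simp add: bG_def C_def power2_eq_square power3_eq_cube field_simps)
  then have "Const (bG E) = Const E * Const \<tau> + Const E * Const C
      - (Const E - 1) * Const q * Const E * Const \<tau>"
    by (simp only: Const_hom)
  ultimately have "HH (D + 1) - GG (D + 1) =
      (Const E * zeta_inv - Const E * Const C - Const E * Const \<tau> + zeta) * p * R
      - p * ((zeta + zeta_inv) * R
        - (Const E * Const \<tau> + Const E * Const C - (Const E - 1) * Const q * Const E * Const \<tau>) * R)"
    by (metis mult.assoc)
  also have "\<dots> = (1 - Const E) * (Const \<tau> * (Const q * Const E) - zeta_inv) * p * R"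
    by algebra
  finally have diff: "HH (D + 1) - GG (D + 1) = Const (1 - E) * (Const (\<tau> * (q * E)) - zeta_inv) * p * R"
    unfolding Const_hom .
  define Q where "Q = qpoch q q (nat D)"
  have "q ^ nat D = E"
    using D_ge by (simp add: E_def flip: power_int_of_nat)
  then have Q: "qpoch q q (nat (D + 1)) = Q * (1 - q * E)"
    using D_ge by (simp add: nat_add_distrib qpoch_Suc Q_def)
  have E1: "q powi (D + 1) = q * E"
    using q_nz by (simp add: E_def power_int_add)
  have "1 - q * E \<noteq> 0"
    using powi_neq_1[of "D + 1"] D_ge unfolding E1 by simp
  moreover have "Q \<noteq> 0"
    by (simp add: Q_def qpoch_q_nz)
  moreover have "1 - E \<noteq> 0"
    by simp
  ultimately have c: "1 / (\<tau> powi (D + 1) * Q * (Q * (1 - q * E))) =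
      - (nu (D + 1) * (1 - q * E)) * (1 - E)"
    using D_ge unfolding nu_def Q by (simp add: power2_eq_square divide_simps) (simp add: algebra_simps)?
  have "ell_plus q \<tau> N D D = Const (1 / (\<tau> powi (D + 1) * Q * (Q * (1 - q * E))))
      * (Const (\<tau> * (q * E)) - zeta_inv) * p * R"
    using D_ge hperp_eq[of "D - 1"] by (simp add: ell_plus_def Q E1 R_def p_def flip: Q_def)
  then show ?thesis
    unfolding c diff E1 Const_mult[of _ "1 - E"] by (simp only: mult.assoc)
qed

section \<open>Expansions of the non-symmetric polynomials over a common normalisation\<close>

lemma zeta_GG_scaled:
  assumes "0 \<le> j" and I: "I = q powi j"
  shows "Const (1 - I) * (zeta * GG j) = Const ((1 - I) * E / (E - 1)) *
    lincomb j (- (vG I * uG I)) (C * uG (q * I) + \<tau> * vG I) (- (1 / E)) (cG I) (bG I - \<tau> - C) 1"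
\<comment> \<open>\<open>zeta_GG\<close> starts at j = 1; at j = 0 the factor \<open>1 - I\<close>,
  which accompanies \<open>GG j\<close> in both families, is 0.\<close>
proof (cases "j = 0")
  case False
  then show ?thesis
    using assms zeta_GG[OF _ I] by (simp add: Const_mult mult.assoc flip: times_divide_eq_right)
qed (simp add: I GG_def RR_def)

lemma X_GG_scaled:
  assumes "0 \<le> j" and I: "I = q powi j"
  shows "Const (1 - I) * ((zeta + zeta_inv) * GG j) = Const (1 - I) * lincomb j 0 0 0 (cG I) (bG I) 1"
proof (cases "j = 0")
  case False
  then show ?thesis
    using assms X_GG_lin[OF _ I] by simp
qed (simp add: I GG_def RR_def)

text \<open>Serves both families: \<open>y\<close> is 1 for \<open>ell_minus\<close> and -1 for
  \<open>ell_plus\<close>.\<close>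

lemma zeta_comb:
  assumes "0 \<le> j" and I: "I = q powi j"
  shows "zeta * (Const n * (Const x * HH j - Const (y * (1 - I)) * GG j)) =
    Const n * (Const (x / (E - 1)) * lincomb j (- cH I) (E * \<tau> + 1 / \<tau> - bH I) (- 1)
        (E * (k1 I * k2 (I / q))) (E * (k1 I + k2 I)) E
     - Const (y * (1 - I) * E / (E - 1)) *
      lincomb j (- (vG I * uG I)) (C * uG (q * I) + \<tau> * vG I) (- (1 / E)) (cG I) (bG I - \<tau> - C) 1)"
  (is "?L = Const n * (_ * ?l1 - _ * ?l2)")
proof -
  have "?L = Const n * (Const x * (zeta * HH j) - Const y * (Const (1 - I) * (zeta * GG j)))"
    unfolding Const_mult[of y "1 - I"] unfolding right_diff_distrib by (simp only: mult_ac)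
  also have "\<dots> = Const n * (Const (x * (1 / (E - 1))) * ?l1 - Const (y * ((1 - I) * E / (E - 1))) * ?l2)"
    unfolding zeta_HH[OF assms] zeta_GG_scaled[OF assms] by (simp only: Const_mult mult.assoc)
  finally show ?thesis by (simp add: mult.assoc)
qed

lemma X_comb:
  assumes "0 \<le> j" and I: "I = q powi j"
  shows "(zeta + zeta_inv) * (Const n * (Const x * HH j - Const (y * (1 - I)) * GG j)) =
    Const n * (Const x * lincomb j (cH I) (bH I) 1 0 0 0
        - Const (y * (1 - I)) * lincomb j 0 0 0 (cG I) (bG I) 1)"
  (is "?L = _")
proof -
  have "?L = Const n * (Const x * ((zeta + zeta_inv) * HH j)
      - Const y * (Const (1 - I) * ((zeta + zeta_inv) * GG j)))"
    unfolding Const_mult[of y "1 - I"] unfolding right_diff_distrib by (simp only: mult_ac)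
  then show ?thesis
    unfolding X_HH_lin[OF assms] X_GG_scaled[OF assms] by (simp only: Const_mult mult.assoc)
qed

lemma nz_1_minus:
  assumes "0 \<le> j"
  shows "1 - q * q powi j \<noteq> 0" "1 - q * (q * q powi j) \<noteq> 0"
  using powi_neq_1[of "j + 1"] powi_neq_1[of "j + 2"] assms q_nz
  by (auto simp: power_int_add power2_eq_square mult_ac)

text \<open>\<open>nu_pred\<close> and \<open>nu_Suc\<close> refer all neighbours to the same factor
  \<open>nu j\<close>, which can then be stripped before coefficients are compared.\<close>

lemma ell_lin:
  assumes "0 \<le> j" "j \<le> D" and I: "I = q powi j"
  shows "ell_minus q \<tau> N D (j - 1) = Const (nu j)
      * (Const (\<tau> * (1 - I)\<^sup>2) * lincomb j (E - I / q) 0 0 (I / q - 1) 0 0)" (is ?e1)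
    and "ell_minus q \<tau> N D j = Const (nu j) * lincomb j 0 (E - I) 0 0 (I - 1) 0" (is ?e2)
    and "ell_plus q \<tau> N D (j - 1) = Const (nu j) * lincomb j 0 (I - 1) 0 0 (1 - I) 0" (is ?e3)
    and "ell_plus q \<tau> N D j = Const (nu j)
        * (Const (1 / (\<tau> * (1 - q * I))) * lincomb j 0 0 (- 1) 0 0 1)" (is ?e4)
    and "1 \<le> j \<Longrightarrow> ell_plus q \<tau> N D (j - 2) =
        Const (nu j) * (Const (\<tau> * (1 - I)\<^sup>2) * lincomb j (I / q - 1) 0 0 (1 - I / q) 0 0)" (is "_
        \<Longrightarrow> ?e5")
    and "j < D \<Longrightarrow> ell_minus q \<tau> N D (j + 1) =
        Const (nu j) * (Const (1 / (\<tau> * (1 - q * I)\<^sup>2))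
        * lincomb j 0 0 (E - q * I) 0 0 (q * I - 1))" (is "_ \<Longrightarrow> ?e6")
proof -
  have Im: "q powi (j - 1) = I / q" and Ip: "q powi (j + 1) = q * I"
    using q_nz by (simp_all add: I power_int_diff power_int_add)
  have nz: "1 - q * I \<noteq> 0"
    using nz_1_minus[OF assms(1)] by (simp add: I)
  show ?e1
    using ell_minus_eq[of "j - 1"] nu_pred[OF assms(1)] assms
    unfolding Im I[symmetric] lincomb_def by (simp add: Const_hom algebra_simps)
  show ?e2
    using ell_minus_eq[of j] assms
    unfolding I[symmetric] lincomb_def by (simp add: Const_hom algebra_simps)
  show ?e3
    using ell_plus_eq_inner[of j] assms
    unfolding I[symmetric] lincomb_def by (simp add: Const_hom Const_uminus algebra_simps)
  have n: "- (nu (j + 1) * (1 - q * I)) = nu j * - (1 / (\<tau> * (1 - q * I)))"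
    using nu_Suc[OF assms(1)] nz by (simp add: I power2_eq_square)
  have "ell_plus q \<tau> N D j = Const (- (nu (j + 1) * (1 - q powi (j + 1)))) * (HH (j + 1) - GG (j + 1))"
    \<comment> \<open>At j = D the boundary polynomial enters, and it obeys the same
      formula.\<close>
    using ell_plus_eq_inner[of "j + 1"] ell_plus_top assms(1,2) by (cases "j = D") simp_all
  then show ?e4
    unfolding Ip n lincomb_def Const_mult[of "nu j"] Const_uminus by (simp add: Const_uminus algebra_simps)
  have n': "nu (j - 1) = nu j * (\<tau> * (1 - I)\<^sup>2)"
    using nu_pred[OF assms(1)] by (simp add: I)
  show ?e5
    if "1 \<le> j"
    using ell_plus_eq_inner[of "j - 1"] assms that
    unfolding Im n' lincomb_def Const_uminus Const_mult[of _ "1 - I / q"] Const_mult[of "nu j"]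
    by (simp add: Const_diff algebra_simps)
  have n: "nu (j + 1) = nu j * (1 / (\<tau> * (1 - q * I)\<^sup>2))"
    using nu_Suc[OF assms(1)] by (simp add: I)
  show ?e6
    if "j < D"
    using ell_minus_eq[of "j + 1"] assms that
    unfolding Ip n lincomb_def Const_mult[of "nu j"] by (simp add: Const_diff Const_mult algebra_simps)
qed

lemmas coeff_defs = bH_def cH_def k1_def k2_def bG_def cG_def uG_def vG_def C_def

lemma lincomb_cong: "a = a' \<Longrightarrow> b = b' \<Longrightarrow> c = c' \<Longrightarrow> d = d' \<Longrightarrow> e = e' \<Longrightarrow> f = f' \<Longrightarrow> lincomb j a b c d e f =
    lincomb j a' b' c' d' e' f'"
  by simp

lemma lincomb_scale_left: "Const x * (Const n * a) = Const n * (Const x * a)"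
  by (simp only: mult.left_commute)

lemma zeta_ell_minus_lin:
  assumes "0 \<le> j" "j \<le> D" and I: "I = q powi j"
  shows "zeta * ell_minus q \<tau> N D j =
      Const (nu j) * (Const ((E - I) / (E - 1)) * lincomb j (- cH I) (E * \<tau> + 1 / \<tau> - bH I) (- 1)
        (E * (k1 I * k2 (I / q))) (E * (k1 I + k2 I)) E
      - Const (1 * (1 - I) * E / (E - 1)) *
        lincomb j (- (vG I * uG I)) (C * uG (q * I) + \<tau> * vG I) (- (1 / E)) (cG I) (bG I - \<tau>
            - C) 1)" (is ?zeta)
    and "(zeta + zeta_inv) * ell_minus q \<tau> N D j =
      Const (nu j) * (Const (E - I) * lincomb j (cH I) (bH I) 1 0 0 0
          - Const (1 * (1 - I)) * lincomb j 0 0 0 (cG I) (bG I) 1)" (is ?X)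
proof -
  have e: "ell_minus q \<tau> N D j = Const (nu j) * (Const (E - I) * HH j - Const (1 * (1 - I)) * GG j)"
    using ell_minus_eq[of j] assms by simp
  show ?zeta
    unfolding e by (rule zeta_comb[OF assms(1) I])
  show ?X
    unfolding e by (rule X_comb[OF assms(1) I])
qed

lemma zeta_ell_plus_lin:
  assumes "0 \<le> j" "j \<le> D" and I: "I = q powi j"
  shows "zeta * ell_plus q \<tau> N D (j - 1) =
      Const (nu j) * (Const ((I - 1) / (E - 1)) * lincomb j (- cH I) (E * \<tau> + 1 / \<tau> - bH I) (- 1)
        (E * (k1 I * k2 (I / q))) (E * (k1 I + k2 I)) E
      - Const (- 1 * (1 - I) * E / (E - 1)) *
        lincomb j (- (vG I * uG I)) (C * uG (q * I) + \<tau> * vG I) (- (1 / E)) (cG I) (bG I - \<tau>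
            - C) 1)" (is ?zeta)
    and "(zeta + zeta_inv) * ell_plus q \<tau> N D (j - 1) =
      Const (nu j) * (Const (I - 1) * lincomb j (cH I) (bH I) 1 0 0 0
          - Const (- 1 * (1 - I)) * lincomb j 0 0 0 (cG I) (bG I) 1)" (is ?X)
proof -
  have e: "ell_plus q \<tau> N D (j - 1) = Const (nu j)
      * (Const (I - 1) * HH j - Const (- 1 * (1 - I)) * GG j)"
    unfolding ell_lin(3)[OF assms] lincomb_def by (simp add: Const_diff algebra_simps)
  show ?zeta
    unfolding e by (rule zeta_comb[OF assms(1) I])
  show ?X
    unfolding e by (rule X_comb[OF assms(1) I])
qed

section \<open>The four identities, with q^D written as \<open>E\<close> and q^(N+1) as the inverse
  square of \<tau>\<close>

lemma zeta_inv_times: "zeta_inv * x = (zeta + zeta_inv) * x - zeta * x"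
  by (simp add: algebra_simps)

text \<open>After \<open>nu i\<close> is stripped, both sides are \<open>lincomb\<close>s, and their
  six coefficients agree as rational functions of q, E, \<tau> and I.\<close>

lemma zeta_ell_minus:
  assumes "0 \<le> i" "i < D" and I: "I = q powi i"
  shows "zeta * ell_minus q \<tau> N D i = Const (\<tau> * (I - E) * (1 / (\<tau>\<^sup>2 * E) - q * I + 1))
      * ell_plus q \<tau> N D (i - 1)
     + Const (\<tau> * I * (1 / (\<tau>\<^sup>2 * E) - q * I + 1)) * ell_minus q \<tau> N D i
     + Const (\<tau> * (1 - q * I) * (E - q * I + 1)) * ell_plus q \<tau> N D i
     + Const (\<tau> * (q * I - 1)\<^sup>2) * ell_minus q \<tau> N D (i + 1)"
proof -
  have i: "i \<le> D" and E1: "E - 1 \<noteq> 0" using assms by simp_all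
  have nz: "1 - q * I \<noteq> 0"
    using nz_1_minus[OF assms(1)] by (simp add: I)
  note l = ell_lin[OF assms(1) i I]
  show ?thesis
    unfolding zeta_ell_minus_lin(1)[OF assms(1) i I]
    unfolding l(6)[OF assms(2)] l(1-4)
    unfolding lincomb_scale_left[of _ "nu i"]
    unfolding distrib_left[of "Const (nu i)", symmetric] right_diff_distrib[of "Const (nu i)", symmetric]
    by (rule arg_cong[where f = "\<lambda>x. Const (nu i)
        * x"], unfold lincomb_scale lincomb_add lincomb_diff, rule lincomb_cong;
      use nz E1 q_nz in \<open>simp add: coeff_defs divide_simps; algebra?\<close>)
qed

lemma zeta_inv_ell_minus:
  assumes "0 \<le> i" "i < D" and I: "I = q powi i"
  shows "zeta_inv * ell_minus q \<tau> N D i =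
      Const (\<tau> * (1 - I / E) * (1 / \<tau>\<^sup>2 - E * I)) * ell_minus q \<tau> N D (i - 1)
     + Const (\<tau> * (E - I) * (1 / (\<tau>\<^sup>2 * E) - I + 1)) * ell_plus q \<tau> N D (i - 1)
     + Const (\<tau> * (q * I) * (E - I + 1)) * ell_minus q \<tau> N D i
     + Const (\<tau> * (q * I - 1) * (E - I + 1)) * ell_plus q \<tau> N D i"
proof -
  have i: "i \<le> D" and E1: "E - 1 \<noteq> 0" using assms by simp_all
  have nz: "1 - q * I \<noteq> 0"
    using nz_1_minus[OF assms(1)] by (simp add: I)
  note l = ell_lin[OF assms(1) i I]
  show ?thesis
    unfolding zeta_inv_times zeta_ell_minus_lin[OF assms(1) i I]
    unfolding l(6)[OF assms(2)] l(1-4)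
    unfolding lincomb_scale_left[of _ "nu i"]
    unfolding distrib_left[of "Const (nu i)", symmetric] right_diff_distrib[of "Const (nu i)", symmetric]
    by (rule arg_cong[where f = "\<lambda>x. Const (nu i)
        * x"], unfold lincomb_scale lincomb_add lincomb_diff, rule lincomb_cong;
      use nz E1 q_nz in \<open>simp add: coeff_defs divide_simps; algebra?\<close>)
qed

text \<open>The plus polynomial of index i = j - 1 lives at level j. \<open>K\<close> stands for
  q^i, so that the stated coefficients avoid division by q.\<close>

lemma zeta_ell_plus:
  assumes "1 \<le> j" "j \<le> D" and I: "q * K = q powi j"
  shows "zeta * ell_plus q \<tau> N D (j - 1) =
      Const (\<tau> * (1 / \<tau>\<^sup>2) * (K / E - 1) * (q * E * \<tau>\<^sup>2 * K - 1)) * ell_plus q \<tau> N D (j - 2)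
     + Const (\<tau> * (K / (\<tau>\<^sup>2 * E)) * (q * E * \<tau>\<^sup>2 * K - 1)) * ell_minus q \<tau> N D (j - 1)
     + Const (\<tau> * (q * K) * (E - q * K + 1)) * ell_plus q \<tau> N D (j - 1)
     + Const (\<tau> * (q * K) * (1 - q * K)) * ell_minus q \<tau> N D j"
proof -
  have j: "0 \<le> j" and E1: "E - 1 \<noteq> 0" using assms by simp_all
  have nz: "1 - q * (q * K) \<noteq> 0"
    using nz_1_minus[OF j] by (simp add: I)
  note l = ell_lin[OF j assms(2) I]
  show ?thesis
    unfolding zeta_ell_plus_lin(1)[OF j assms(2) I]
    unfolding l(5)[OF assms(1)] l(1-4)
    unfolding lincomb_scale_left[of _ "nu j"]
    unfolding distrib_left[of "Const (nu j)", symmetric] right_diff_distrib[of "Const (nu j)", symmetric]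
    by (rule arg_cong[where f = "\<lambda>x. Const (nu j)
        * x"], unfold lincomb_scale lincomb_add lincomb_diff, rule lincomb_cong;
      use nz E1 q_nz in \<open>simp add: coeff_defs divide_simps; algebra?\<close>)
qed

lemma zeta_inv_ell_plus:
  assumes "1 \<le> j" "j \<le> D" and I: "q * K = q powi j"
  shows "zeta_inv * ell_plus q \<tau> N D (j - 1) =
      Const (\<tau> * (q * K / (\<tau>\<^sup>2 * E)) * (1 - q * E * \<tau>\<^sup>2 * K)) * ell_minus q \<tau> N D (j - 1)
     + Const (\<tau> * (q * K) * (1 / (\<tau>\<^sup>2 * E) - q * K + 1)) * ell_plus q \<tau> N D (j - 1)
     + Const (\<tau> * (q * (q * K)) * (q * K - 1)) * ell_minus q \<tau> N D j
     + Const (\<tau> * (q * K - 1) * (q * (q * K) - 1)) * ell_plus q \<tau> N D j"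
proof -
  have j: "0 \<le> j" and E1: "E - 1 \<noteq> 0" using assms by simp_all
  have nz: "1 - q * (q * K) \<noteq> 0"
    using nz_1_minus[OF j] by (simp add: I)
  note l = ell_lin[OF j assms(2) I]
  show ?thesis
    unfolding zeta_inv_times zeta_ell_plus_lin[OF j assms(2) I]
    unfolding l(5)[OF assms(1)] l(1-4)
    unfolding lincomb_scale_left[of _ "nu j"]
    unfolding distrib_left[of "Const (nu j)", symmetric] right_diff_distrib[of "Const (nu j)", symmetric]
    by (rule arg_cong[where f = "\<lambda>x. Const (nu j)
        * x"], unfold lincomb_scale lincomb_add lincomb_diff, rule lincomb_cong;
      use nz E1 q_nz in \<open>simp add: coeff_defs divide_simps; algebra?\<close>)
qed

end

theorem theorem9p2:
  fixes p :: nat and q \<tau> :: complex and N D i :: int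
  assumes "primepow p"
    and "q = of_nat p"
    and "D \<ge> 3"
    and "N \<ge> 2 * D"
    and "\<tau> = - complex_of_real (real p powr ((- real_of_int N - 1) / 2))"
    and "0 \<le> i"
    and "i \<le> D - 1"
  shows
    "(zeta * ell_minus q \<tau> N D i =
       Const (\<tau> * (q powi i - q powi D) * (q powi (N - D + 1) - q powi (i + 1) + 1)) * ell_plus q \<tau> N D (i - 1)
     + Const (\<tau> * q powi i * (q powi (N - D + 1) - q powi (i + 1) + 1)) * ell_minus q \<tau> N D i
     + Const (\<tau> * (1 - q powi (i + 1)) * (q powi D - q powi (i + 1) + 1)) * ell_plus q \<tau> N D i
     + Const (\<tau> * (q powi (i + 1) - 1)\<^sup>2) * ell_minus q \<tau> N D (i + 1))
     \<and> (zeta_inv * ell_minus q \<tau> N D i =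
       Const (\<tau> * (1 - q powi (i - D)) * (q powi (N + 1) - q powi (D + i))) * ell_minus q \<tau> N D (i - 1)
     + Const (\<tau> * (q powi D - q powi i) * (q powi (N - D + 1) - q powi i + 1)) * ell_plus q \<tau> N D (i - 1)
     + Const (\<tau> * q powi (i + 1) * (q powi D - q powi i + 1)) * ell_minus q \<tau> N D i
     + Const (\<tau> * (q powi (i + 1) - 1) * (q powi D - q powi i + 1)) * ell_plus q \<tau> N D i)
     \<and> (zeta * ell_plus q \<tau> N D i =
       Const (\<tau> * q powi (N + 1) * (q powi (i - D) - 1) * (q powi (D - N + i) - 1)) * ell_plus q \<tau> N D (i - 1)
     + Const (\<tau> * q powi (N - D + 1 + i) * (q powi (D - N + i) - 1)) * ell_minus q \<tau> N D i
     + Const (\<tau> * q powi (i + 1) * (q powi D - q powi (i + 1) + 1)) * ell_plus q \<tau> N D i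
     + Const (\<tau> * q powi (i + 1) * (1 - q powi (i + 1))) * ell_minus q \<tau> N D (i + 1))
     \<and> (zeta_inv * ell_plus q \<tau> N D i =
       Const (\<tau> * q powi (N - D + 2 + i) * (1 - q powi (D - N + i))) * ell_minus q \<tau> N D i
     + Const (\<tau> * q powi (i + 1) * (q powi (N - D + 1) - q powi (i + 1) + 1)) * ell_plus q \<tau> N D i
     + Const (\<tau> * q powi (i + 2) * (q powi (i + 1) - 1)) * ell_minus q \<tau> N D (i + 1)
     + Const (\<tau> * (q powi (i + 1) - 1) * (q powi (i + 2) - 1)) * ell_plus q \<tau> N D (i + 1))"
proof -
  have p: "2 \<le> p"
    using assms(1) primepow_gt_Suc_0 by fastforce
  have tau_sq: "\<tau>\<^sup>2 = q powi (- N - 1)"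
  proof -
    have "\<tau>\<^sup>2 = complex_of_real ((real p powr ((- real_of_int N - 1) / 2))\<^sup>2)"
      unfolding assms(5) by simp
    also have "(real p powr ((- real_of_int N - 1) / 2))\<^sup>2 = real p powr (of_int (- N - 1))"
      by (simp add: power2_eq_square flip: powr_add)
    also have "\<dots> = real p powi (- N - 1)"
      using p by (intro powr_real_of_int') auto
    finally show ?thesis
      by (simp add: assms(2))
  qed
  have powi_neq_1: "q powi k \<noteq> 1" if "k \<noteq> 0" for k
  proof -
    have "q ^ n \<noteq> 1" if "n \<noteq> 0" for n
      using that p by (simp add: assms(2) flip: of_nat_power)
    then show ?thesis
      using that by (cases k rule: int_cases3) (auto simp: power_int_minus)
  qed
  interpret dual_q_hahn q \<tau> N D
    using assms(2-4) p tau_sq powi_neq_1 by unfold_locales auto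
  \<comment> \<open>Through this relation every power of q involving N becomes an expression in
    \<tau>, \<open>E\<close> and \<open>q powi i\<close>.\<close>
  have "q powi (N + 1) * \<tau>\<^sup>2 = 1"
    using q_nz by (simp add: tau_sq flip: power_int_add)
  then have N: "q powi (N + 1) = 1 / \<tau>\<^sup>2"
    by (simp add: eq_divide_eq)
  have M: "q powi (N - D + 1) = 1 / (\<tau>\<^sup>2 * E)"
    using N q_nz power_int_diff[of q "N + 1" D] by (simp add: E_def algebra_simps)
  have M': "q powi (N - D + 1 + i) = q powi i / (\<tau>\<^sup>2 * E)"
    "q powi (N - D + 2 + i) = q * q powi i / (\<tau>\<^sup>2 * E)"
    using M q_nz power_int_add[of q "N - D + 1" i] power_int_add[of q "N - D + 1 + i" 1]
    by (simp_all add: algebra_simps)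
  have "q powi (D - N + i) = q powi (D + i + 1) / q powi (N + 1)"
    using q_nz power_int_diff[of q "D + i + 1" "N + 1"] by (simp add: algebra_simps)
  then have powi: "q powi (i - D) = q powi i / E" "q powi (D + i) = E * q powi i"
    "q powi (i + 1) = q * q powi i" "q powi (i + 2) = q * (q * q powi i)"
    "q powi (D - N + i) = q * E * \<tau>\<^sup>2 * q powi i"
    using q_nz by (simp_all add: N E_def power_int_diff power_int_add power2_eq_square)
  have i: "0 \<le> i" "i < D" "1 \<le> i + 1" "i + 1 \<le> D"
    using assms(6,7) by simp_all
  \<comment> \<open>The plus identities are used at level i + 1, with \<open>K\<close> =
    q^i.\<close>
  have j: "i + 1 - 1 = i" "i + 1 - 2 = i - 1" "q * q powi i = q powi (i + 1)"
    by (simp_all add: powi)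
  show ?thesis
    unfolding powi M M' N E_def[symmetric]
    using zeta_ell_minus[OF i(1,2) refl] zeta_inv_ell_minus[OF i(1,2) refl]
      zeta_ell_plus[OF i(3,4) j(3)] zeta_inv_ell_plus[OF i(3,4) j(3)]
    unfolding j(1,2) by (intro conjI)
qed

end
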